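(* Let $p$ be a positive odd integer. The operators $\mathbf L_n$, $n\in\mathbb Z$, generate a Virasoro algebra with central charge $p$: $$[\mathbf L_n,\mathbf L_m]=(n-m)\mathbf L_{n+m}+\delta_{n+m,0}\,\frac{n^3-n}{12}\,p\qquad\text{for all } n,m\in\mathbb Z .$$
   Context: The operators act on $\mathbb C[t_1,t_3,t_5,\dots]$, with $\partial_{2n+1}=\partial/\partial t_{2n+1}$. Define $$Z^{(2)}_{2kp}=2\sum_{n=0}^{kp-1}\partial_{2n+1}\partial_{2kp-2n-1}+2\sum_{n=0}^\infty(2n+1)t_{2n+1}\partial_{2kp+2n+1}\quad(k\ge0),$$ $$Z^{(2)}_{2kp}=\frac12\sum_{n=0}^{-kp-1}(2n+1)(-2kp-2n-1)t_{2n+1}t_{-2kp-2n-1}+2\sum_{n=0}^\infty(2n+1-2kp)t_{2n+1-2kp}\partial_{2n+1}\quad(k<0),$$ and, for $n\in\mathbb Z$, $$\mathbf L_n=\frac{1}{4p}Z^{(2)}_{2np}+\delta_{n,0}\left(\frac1{16p}+\frac{p^2-1}{24p}\right).$$ *)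

theory Defs
  imports Complex_Main "HOL-Library.Poly_Mapping" "HOL-Library.Groups_Big_Fun"
begin

text \<open>
  The ring of complex polynomials in the variables \<open>t\<^sub>1, t\<^sub>3, t\<^sub>5, \<dots>\<close>: a monomial is a
  finitely supported exponent function, whose value at \<open>j\<close> is the exponent of \<open>t\<close> with
  subscript \<open>2j+1\<close>. So there are no variables with even subscript.
\<close>

type_synonym tpoly = "(nat \<Rightarrow>\<^sub>0 nat) \<Rightarrow>\<^sub>0 complex"

definition slot :: "int \<Rightarrow> nat" where
  "slot i = nat (i div 2)"

lemma slot_odd [simp]: "slot (2 * int j + 1) = j"
  by (simp add: slot_def)

text \<open>\<^const>\<open>slot\<close>, and hence \<open>tvar\<close> and \<open>dvar\<close> below, are meaningful only at odd positive
  subscripts, and are used only there.\<close>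

definition tconst :: "complex \<Rightarrow> tpoly" where
  "tconst c = Poly_Mapping.single 0 c"

definition tvar :: "int \<Rightarrow> tpoly" where
  "tvar i = Poly_Mapping.single (Poly_Mapping.single (slot i) 1) 1"

text \<open>When the exponent is 0, the truncated subtraction is harmless since the coefficient
  vanishes.\<close>

definition dvar :: "int \<Rightarrow> tpoly \<Rightarrow> tpoly" where
  "dvar i f = (\<Sum>m\<in>Poly_Mapping.keys f.
     Poly_Mapping.single (m - Poly_Mapping.single (slot i) 1)
       (of_nat (Poly_Mapping.lookup m (slot i)) * Poly_Mapping.lookup f m))"

lemma dvar_single:
  "dvar i (Poly_Mapping.single m c) =
     Poly_Mapping.single (m - Poly_Mapping.single (slot i) 1)
       (of_nat (Poly_Mapping.lookup m (slot i)) * c)"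
  by (cases "c = 0") (simp_all add: dvar_def)

lemma dvar_add: "dvar i (f + g) = dvar i f + dvar i g"
proof -
  let ?d = "\<lambda>h m. Poly_Mapping.single (m - Poly_Mapping.single (slot i) 1)
       (of_nat (Poly_Mapping.lookup m (slot i)) * Poly_Mapping.lookup h m)"
  let ?K = "Poly_Mapping.keys f \<union> Poly_Mapping.keys g"
  have sup: "dvar i h = (\<Sum>m\<in>?K. ?d h m)" if "Poly_Mapping.keys h \<subseteq> ?K" for h :: tpoly
    unfolding dvar_def by (rule sum.mono_neutral_left) (use that in \<open>auto simp: in_keys_iff\<close>)
  have "dvar i (f + g) = (\<Sum>m\<in>?K. ?d (f + g) m)"
    by (rule sup) (rule Poly_Mapping.keys_add)
  also have "\<dots> = (\<Sum>m\<in>?K. ?d f m) + (\<Sum>m\<in>?K. ?d g m)"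
    by (simp add: lookup_add algebra_simps single_add sum.distrib)
  also have "\<dots> = dvar i f + dvar i g"
    by (simp add: sup)
  finally show ?thesis .
qed

text \<open>The infinite sums in the operators have only finitely many nonzero terms when applied
  to a polynomial, so that \<^const>\<open>Sum_any\<close> computes them.\<close>

lemma finite_dvar_nonzero: "finite {n::nat. dvar (a + 2 * int n + 1) f \<noteq> 0}"
proof -
  have "{n. dvar (a + 2 * int n + 1) f \<noteq> 0}
      \<subseteq> {n. slot (a + 2 * int n + 1) \<in> (\<Union>m\<in>Poly_Mapping.keys f. Poly_Mapping.keys m)}"
    by (auto simp: dvar_def in_keys_iff intro!: sum.neutral intro: ccontr)
  also have "\<dots> \<subseteq> (\<Union>j\<in>(\<Union>m\<in>Poly_Mapping.keys f. Poly_Mapping.keys m).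
      {n. slot (a + 2 * int n + 1) = j})"
    by blast
  finally have sub: "{n. dvar (a + 2 * int n + 1) f \<noteq> 0} \<subseteq> \<dots>" .
  have "finite {n. slot (a + 2 * int n + 1) = j}" for j
    by (rule finite_subset[of _ "{..nat (int j + \<bar>a\<bar> + 1)}"]) (auto simp: slot_def)
  then have "finite (\<Union>j\<in>(\<Union>m\<in>Poly_Mapping.keys f. Poly_Mapping.keys m).
      {n. slot (a + 2 * int n + 1) = j})"
    by (intro finite_UN_I) auto
  with sub show ?thesis
    by (rule finite_subset)
qed

definition Z2 :: "nat \<Rightarrow> int \<Rightarrow> tpoly \<Rightarrow> tpoly" where
  "Z2 p k f =
    (if k \<ge> 0 then
       2 * (\<Sum>n\<in>{0..k * int p - 1}. dvar (2*n + 1) (dvar (2*k*int p - 2*n - 1) f))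
       + 2 * Sum_any (\<lambda>n::nat. of_nat (2*n + 1) * tvar (2*int n + 1)
                                * dvar (2*k*int p + 2*int n + 1) f)
     else
       tconst (1/2) * (\<Sum>n\<in>{0..- k * int p - 1}.
           of_int ((2*n + 1) * (- 2*k*int p - 2*n - 1))
             * tvar (2*n + 1) * tvar (- 2*k*int p - 2*n - 1) * f)
       + 2 * Sum_any (\<lambda>n::nat. of_int (2*int n + 1 - 2*k*int p)
                                * tvar (2*int n + 1 - 2*k*int p) * dvar (2*int n + 1) f))"

definition Lop :: "nat \<Rightarrow> int \<Rightarrow> tpoly \<Rightarrow> tpoly" where
  "Lop p n f =
     tconst (1 / (4 * of_nat p)) * Z2 p n f
     + tconst (if n = 0 then 1 / (16 * of_nat p) + (of_nat p ^ 2 - 1) / (24 * of_nat p) else 0) * f"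

definition commutator :: "(tpoly \<Rightarrow> tpoly) \<Rightarrow> (tpoly \<Rightarrow> tpoly) \<Rightarrow> tpoly \<Rightarrow> tpoly" where
  "commutator A B = (\<lambda>f. A (B f) - B (A f))"

end

(* With J_i = d/dt_i and J_{-i} = (i/2) t_i for odd i > 0 one has [J_i, J_j] = (i/2) delta_{i+j,0},
   and Z2_{2N} is twice the sum over all odd i of the normally ordered products :J_i J_{2N-i}:.
   Normal ordering changes a product only by a scalar, so the commutator of that sum K_N with J_i is
   -i J_{2N+i}. By the Jacobi identity [K_N, K_M] - 2 (N - M) K_{N+M} commutes with every J_i, so it
   is a scalar, which is read off from the constant term of its value at the polynomial 1.
   This scalar is (2 N^3 + N) / 6 for N + M = 0; at N = n p the constant in L_0 turns it into
   the standard cocycle. *)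

theory Submission
  imports Defs
begin

section \<open>Scalars and induction on polynomials\<close>

lemma poly_mapping_single_induct [case_names single add]:
  assumes "\<And>m c. P (Poly_Mapping.single m c)"
    and "\<And>f g. P f \<Longrightarrow> P g \<Longrightarrow> P (f + g)"
  shows "P (f :: 'a \<Rightarrow>\<^sub>0 'b::comm_monoid_add)"
proof (induction f rule: update_induct)
  case const
  show ?case using assms(1)[of undefined 0] by simp
next
  case (update f a b)
  have "Poly_Mapping.update a b f = Poly_Mapping.single a b + f"
    using update(1)
    by (intro poly_mapping_eqI) (auto simp: lookup_update lookup_add lookup_single in_keys_iff)
  then show ?case using assms update by simp
qed

lemma tconst_0 [simp]: "tconst 0 = 0"
  and tconst_1 [simp]: "tconst 1 = 1"
  by (simp_all add: tconst_def)

lemma tconst_add: "tconst (a + b) = tconst a + tconst b"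
  and tconst_diff: "tconst (a - b) = tconst a - tconst b"
  and tconst_uminus: "tconst (- a) = - tconst a"
  and tconst_mult: "tconst (a * b) = tconst a * tconst b"
  by (simp_all add: tconst_def single_add single_diff single_uminus mult_single)

lemma lookup_0_tconst [simp]: "Poly_Mapping.lookup (tconst c) 0 = c"
  by (simp add: tconst_def)

lemma of_nat_eq_tconst: "of_nat k = tconst (of_nat k)"
  by (simp add: tconst_def)

lemma of_int_eq_tconst: "of_int k = tconst (of_int k)"
  by (simp add: tconst_def)

lemma numeral_eq_tconst: "numeral k = tconst (numeral k)"
  by (simp add: tconst_def)

lemma single_eq_tconst_times: "Poly_Mapping.single m c = tconst c * Poly_Mapping.single m 1"
  by (simp add: tconst_def mult_single)

text \<open>Every monomial arises from 1 by multiplying in one variable at a time. Later this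
  propagates the vanishing of an operator from the polynomial 1 to the whole ring.\<close>

lemma tpoly_induct [case_names one add tconst tvar]:
  assumes one: "P 1"
    and add: "\<And>f g. P f \<Longrightarrow> P g \<Longrightarrow> P (f + g)"
    and tconst: "\<And>c f. P f \<Longrightarrow> P (tconst c * f)"
    and tvar: "\<And>j f. P f \<Longrightarrow> P (tvar (2 * int j + 1) * f)"
  shows "P f"
proof (induction f rule: poly_mapping_single_induct)
  case (single m c)
  \<comment> \<open>With an arbitrary factor \<open>f\<close>, a sum of exponents is treated by
    multiplying twice.\<close>
  have "P f \<Longrightarrow> P (Poly_Mapping.single m 1 * f)" for f
  proof (induction m arbitrary: f rule: poly_mapping_single_induct)
    case (single j k)
    then show ?case
    proof (induction k)
      case (Suc k)
      have "Poly_Mapping.single (Poly_Mapping.single j (Suc k)) 1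
          = tvar (2 * int j + 1) * Poly_Mapping.single (Poly_Mapping.single j k) (1 :: complex)"
        by (simp add: tvar_def mult_single flip: single_add)
      then show ?case using tvar Suc by (simp add: mult.assoc)
    qed simp
  next
    case (add m m')
    have "Poly_Mapping.single (m + m') (1 :: complex)
        = Poly_Mapping.single m 1 * Poly_Mapping.single m' 1"
      by (simp add: mult_single)
    then show ?case using add by (simp add: mult.assoc)
  qed
  from this[OF one] have "P (Poly_Mapping.single m 1)" by simp
  then show ?case
    using tconst by (subst single_eq_tconst_times) blast
next
  case (add f g)
  then show ?case by (rule assms(2))
qed

section \<open>Derivatives and multiplication by variables\<close>

lemma lookup_dvar:
  "Poly_Mapping.lookup (dvar i f) m = of_nat (Poly_Mapping.lookup m (slot i) + 1) *
     Poly_Mapping.lookup f (m + Poly_Mapping.single (slot i) 1)"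
proof (induction f rule: poly_mapping_single_induct)
  case (single m' c)
  show ?case
  proof (cases "m' = m + Poly_Mapping.single (slot i) 1")
    case True
    then show ?thesis by (simp add: dvar_single lookup_add)
  next
    case False
    \<comment> \<open>Truncated subtraction can be undone only at a positive exponent; at exponent 0
      the coefficient in \<open>dvar_single\<close> vanishes.\<close>
    have "m' = m + Poly_Mapping.single (slot i) 1"
      if "m' - Poly_Mapping.single (slot i) 1 = m" "Poly_Mapping.lookup m' (slot i) \<noteq> 0"
      using that
      by (intro poly_mapping_eqI) (auto simp: lookup_add lookup_minus lookup_single when_def)
    with False show ?thesis
      by (auto simp: dvar_single lookup_single when_def)
  qed
next
  case (add f g)
  then show ?case by (simp add: dvar_add lookup_add algebra_simps)
qed

lemma dvar_commute: "dvar i (dvar j f) = dvar j (dvar i f)"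
  by (rule poly_mapping_eqI)
    (auto simp: lookup_dvar lookup_add lookup_single when_def algebra_simps)

lemma lookup_tconst_times [simp]:
  "Poly_Mapping.lookup (tconst c * f) m = c * Poly_Mapping.lookup f m"
proof (induction f rule: poly_mapping_single_induct)
  case (single m' c')
  then show ?case by (simp add: tconst_def mult_single lookup_single when_def)
next
  case (add f g)
  then show ?case by (simp add: lookup_add distrib_left)
qed

lemma lookup_0_tvar_times [simp]: "Poly_Mapping.lookup (tvar i * f) 0 = 0"
proof (induction f rule: poly_mapping_single_induct)
  case (single m c)
  have "Poly_Mapping.lookup (Poly_Mapping.single (slot i) 1 + m) (slot i) \<noteq> 0"
    by (simp add: lookup_add)
  then have "Poly_Mapping.single (slot i) 1 + m \<noteq> 0" by (metis lookup_zero)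
  then show ?case by (simp add: tvar_def mult_single lookup_single when_def)
next
  case (add f g)
  then show ?case by (simp add: lookup_add distrib_left)
qed

lemma dvar_tconst_times: "dvar i (tconst c * f) = tconst c * dvar i f"
  by (rule poly_mapping_eqI) (simp add: lookup_dvar)

lemma dvar_one [simp]: "dvar i 1 = 0"
  using dvar_single[of i 0 1] by simp

lemma dvar_tvar_times:
  "dvar i (tvar j * f) = (if slot i = slot j then f else 0) + tvar j * dvar i f"
proof (induction f rule: poly_mapping_single_induct)
  case (single m c)
  let ?e = "\<lambda>i. Poly_Mapping.single (slot i) (1::nat)"
  have "?e j + m - ?e i = ?e j + (m - ?e i)" if "Poly_Mapping.lookup m (slot i) \<noteq> 0"
    using that
    by (intro poly_mapping_eqI) (auto simp: lookup_add lookup_minus lookup_single when_def)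
  then show ?case
    by (cases "Poly_Mapping.lookup m (slot i) = 0")
      (auto simp: tvar_def dvar_single mult_single lookup_add lookup_single when_def
         distrib_right single_add)
next
  case (add f g)
  then show ?case by (simp add: dvar_add algebra_simps)
qed

text \<open>Characteristic zero: a nonconstant monomial contains some variable, and differentiating
  by it multiplies the coefficient by a positive exponent, so that coefficient must already be
  0.\<close>

lemma tpoly_eq_0I:
  assumes d: "\<And>j::nat. dvar (2 * int j + 1) f = 0" and c: "Poly_Mapping.lookup f 0 = 0"
  shows "f = 0"
proof (rule poly_mapping_eqI)
  fix m :: "nat \<Rightarrow>\<^sub>0 nat"
  show "Poly_Mapping.lookup f m = Poly_Mapping.lookup 0 m"
  proof (cases "m = 0")
    case False
    then obtain j where j: "Poly_Mapping.lookup m j \<noteq> 0"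
      by (metis lookup_zero poly_mapping_eqI)
    let ?m = "m - Poly_Mapping.single j 1"
    have "?m + Poly_Mapping.single j 1 = m"
      using j by (intro poly_mapping_eqI) (auto simp: lookup_add lookup_minus lookup_single when_def)
    moreover have "Poly_Mapping.lookup (dvar (2 * int j + 1) f) ?m = 0"
      using d by simp
    ultimately have "of_nat (Suc (Poly_Mapping.lookup ?m j)) * Poly_Mapping.lookup f m = 0"
      by (simp add: lookup_dvar)
    then show ?thesis by (simp del: of_nat_Suc)
  qed (use c in simp)
qed

section \<open>Currents and their Heisenberg relations\<close>

text \<open>\<open>J a\<close> is the current with odd subscript \<open>2a + 1\<close>, so that \<open>J a\<close> and \<open>J (-a - 1)\<close> are
  conjugate, and \<open>2a + 1\<close> and its partner in \<open>K N\<close>, of index \<open>N - 1 - a\<close>, add up to \<open>2N\<close>.\<close>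

definition J :: "int \<Rightarrow> tpoly \<Rightarrow> tpoly" where
  "J a f = (if a \<ge> 0 then dvar (2*a + 1) f
            else tconst (- (2 * of_int a + 1) / 2) * tvar (- (2*a + 1)) * f)"

lemma J_neg:
  "a < 0 \<Longrightarrow> J a f = tconst (- (2 * of_int a + 1) / 2) * (tvar (- (2*a + 1)) * f)"
  by (simp add: J_def mult.assoc)

lemma J_add: "J a (f + g) = J a f + J a g"
  by (simp add: J_def dvar_add distrib_left)

lemma J_tconst_times: "J a (tconst c * f) = tconst c * J a f"
  by (simp add: J_def dvar_tconst_times mult.left_commute)

lemma J_0 [simp]: "J a 0 = 0"
  using J_tconst_times[of a 0 0] by simp

lemma J_uminus: "J a (- f) = - J a f"
  using J_tconst_times[of a "-1" f] by (simp add: tconst_uminus)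

lemma J_diff: "J a (f - g) = J a f - J a g"
  using J_add[of a f "- g"] by (simp add: J_uminus)

lemma J_sum: "J a (sum f A) = (\<Sum>x\<in>A. J a (f x))"
  by (induction A rule: infinite_finite_induct) (simp_all add: J_add)

lemma J_one [simp]: "a \<ge> 0 \<Longrightarrow> J a 1 = 0"
  by (simp add: J_def)

lemma lookup_0_J_neg [simp]: "a < 0 \<Longrightarrow> Poly_Mapping.lookup (J a f) 0 = 0"
  by (simp add: J_def mult.assoc)

text \<open>This is the Leibniz rule: the extra term appears when the derivative hits the variable
  that \<open>J b\<close> multiplies by, and the weight of \<open>J b\<close> is then
  \<open>(2a + 1) / 2\<close>.\<close>

lemma J_commute_pos_neg:
  assumes "a \<ge> 0" "b < 0"
  shows "J a (J b f)
    = J b (J a f) + tconst (if a + b + 1 = 0 then (2 * of_int a + 1) / 2 else 0) * f"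
proof -
  have eq: "slot (2*a + 1) = slot (- (2*b + 1)) \<longleftrightarrow> a + b + 1 = 0"
    using assms by (auto simp: slot_def)
  show ?thesis
  proof (cases "a + b + 1 = 0")
    case True
    then have b: "b = - a - 1" by simp
    have c: "- (2 * of_int b + 1) / 2 = ((2 * of_int a + 1) / 2 :: complex)"
      by (simp add: b field_simps)
    have "J a (J b f)
        = tconst ((2 * of_int a + 1) / 2) * dvar (2*a + 1) (tvar (- (2*b + 1)) * f)"
      unfolding J_neg[OF assms(2)] c using assms(1) by (simp add: J_def dvar_tconst_times)
    also have "\<dots> = J b (J a f) + tconst ((2 * of_int a + 1) / 2) * f"
      unfolding J_neg[OF assms(2)] c dvar_tvar_times
      using assms(1) True eq by (simp add: J_def distrib_left)
    finally show ?thesis using True by simp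
  next
    case False
    then show ?thesis
      using assms eq by (simp add: J_def mult.assoc dvar_tconst_times dvar_tvar_times)
  qed
qed

lemma J_commute:
  "J a (J b f) = J b (J a f) + tconst (if a + b + 1 = 0 then (2 * of_int a + 1) / 2 else 0) * f"
proof -
  consider "a \<ge> 0" "b \<ge> 0" | "a \<ge> 0" "b < 0" | "a < 0" "b \<ge> 0" | "a < 0" "b < 0"
    by linarith
  then show ?thesis
  proof cases
    case 1
    then show ?thesis by (simp add: J_def dvar_commute)
  next
    case 2
    then show ?thesis by (rule J_commute_pos_neg)
  next
    case 3
    let ?c = "\<lambda>a b. if a + b + 1 = 0 then (2 * of_int a + 1) / 2 else 0 :: complex"
    \<comment> \<open>Antisymmetry of the central term reduces this case to the previous one with
      \<open>a\<close> and \<open>b\<close> exchanged.\<close>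
    have "?c a b = - ?c b a"
    proof (cases "a + b + 1 = 0")
      case True
      then have a: "a = - b - 1" by simp
      show ?thesis by (simp add: a field_simps)
    qed auto
    then have "tconst (?c a b) = - tconst (?c b a)"
      by (simp only: tconst_uminus)
    then show ?thesis
      using J_commute_pos_neg[OF 3(2,1), of f] by simp
  next
    case 4
    then show ?thesis by (simp add: J_def mult_ac)
  qed
qed

section \<open>Normally ordered products and the quadratic operators\<close>

text \<open>Ordering by index is normal ordering: for opposite signs the derivative acts first, and
  for equal signs the currents commute.\<close>

definition nord :: "int \<Rightarrow> int \<Rightarrow> tpoly \<Rightarrow> tpoly" where
  "nord a b f = (if a \<le> b then J a (J b f) else J b (J a f))"

text \<open>\<open>J l\<close> passes each factor at the cost of a scalar, so the correction is the
  same for either order of the factors.\<close>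

lemma nord_J:
  "nord a b (J l f) = J l (nord a b f)
     + tconst (if b + l + 1 = 0 then (2 * of_int b + 1) / 2 else 0) * J a f
     + tconst (if a + l + 1 = 0 then (2 * of_int a + 1) / 2 else 0) * J b f"
  unfolding nord_def
  by (cases "a \<le> b")
    (simp_all only: if_True if_False J_commute[of a l] J_commute[of b l] J_add J_tconst_times add_ac)

text \<open>The doubled sum collects the products of one \<open>t\<close> and one derivative: each occurs twice in
  the sum over all odd subscripts, at \<open>a\<close> and at \<open>N - 1 - a\<close>.\<close>

definition K :: "int \<Rightarrow> tpoly \<Rightarrow> tpoly" where
  "K N f = (\<Sum>a\<in>{min 0 N..<max 0 N}. J a (J (N - 1 - a) f))
     + 2 * Sum_any (\<lambda>n::nat. J (min 0 N - 1 - int n) (J (max 0 N + int n) f))"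

lemma finite_J_nonzero:
  assumes "h \<ge> 0"
  shows "finite {n::nat. J (l - int n) (J (h + int n) f) \<noteq> 0}"
proof (rule finite_subset)
  show "{n::nat. J (l - int n) (J (h + int n) f) \<noteq> 0} \<subseteq> {n. dvar (2*h + 2 * int n + 1) f \<noteq> 0}"
    using assms by (auto simp: J_def[of "h + _"] distrib_left)
qed (rule finite_dvar_nonzero)

text \<open>The window is invariant under \<open>a \<mapsto> N - 1 - a\<close>. Since all large
  \<open>B\<close> work, several such equations share one window, and identities for
  \<open>K\<close> reduce to finite sums.\<close>

lemma K_eq_sum_nord:
  "\<forall>\<^sub>F B in sequentially. K N f = (\<Sum>a\<in>{N - int B..<int B}. nord a (N - 1 - a) f)"
proof -
  define lo hi where "lo = min 0 N" and "hi = max 0 N"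
  define g where "g n = J (lo - 1 - int n) (J (hi + int n) f)" for n
  have "finite {n. g n \<noteq> 0}"
    unfolding g_def by (rule finite_J_nonzero) (simp add: hi_def)
  then obtain B0 where B0: "g n \<noteq> 0 \<Longrightarrow> n < B0" for n
    by (auto simp: finite_nat_set_iff_bounded)
  show ?thesis
    using eventually_ge_at_top[of "nat hi + B0"]
  proof eventually_elim
    case (elim B)
    \<comment> \<open>As \<open>lo + hi = N\<close>, the window extends the middle block by
      \<open>r\<close> indices on each side.\<close>
    define r where "r = B - nat hi"
    have r: "int B = hi + int r" "N - int B = lo - int r" "r \<ge> B0"
      using elim by (auto simp: r_def hi_def lo_def)
    have Sg: "Sum_any g = (\<Sum>n<r. g n)"
      using B0 r(3) by (intro Sum_any.expand_superset) fastforce+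
    have split: "{N - int B..<int B} = {lo - int r..<lo} \<union> {lo..<hi} \<union> {hi..<hi + int r}"
      using r by (auto simp: lo_def hi_def)
    have e: "N + (- 1 - a) = N - 1 - a" "- 1 - (a - N) = N - 1 - a" for a by simp_all
    have "(\<Sum>a\<in>{N - int B..<int B}. nord a (N - 1 - a) f)
        = (\<Sum>a\<in>{lo - int r..<lo}. nord a (N - 1 - a) f) + (\<Sum>a\<in>{lo..<hi}. nord a (N - 1 - a) f)
          + (\<Sum>a\<in>{hi..<hi + int r}. nord a (N - 1 - a) f)"
      unfolding split by (subst sum.union_disjoint; (subst sum.union_disjoint)?) (auto simp: lo_def hi_def)
    \<comment> \<open>The partner of \<open>lo - 1 - n\<close> is \<open>hi + n\<close>, so both
      outer blocks give the same sum; hence the factor 2 in \<open>K\<close>.\<close>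
    also have "(\<Sum>a\<in>{lo - int r..<lo}. nord a (N - 1 - a) f) = (\<Sum>n<r. g n)"
      by (rule sum.reindex_bij_witness[of _ "\<lambda>n. lo - 1 - int n" "\<lambda>a. nat (lo - 1 - a)"])
        (auto simp: g_def nord_def lo_def hi_def min_def max_def e split: if_splits)
    also have "(\<Sum>a\<in>{hi..<hi + int r}. nord a (N - 1 - a) f) = (\<Sum>n<r. g n)"
      by (rule sum.reindex_bij_witness[of _ "\<lambda>n. hi + int n" "\<lambda>a. nat (a - hi)"])
        (auto simp: g_def nord_def lo_def hi_def min_def max_def e split: if_splits)
    also have "(\<Sum>a\<in>{lo..<hi}. nord a (N - 1 - a) f) = (\<Sum>a\<in>{lo..<hi}. J a (J (N - 1 - a) f))"
    proof (rule sum.cong)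
      fix a assume "a \<in> {lo..<hi}"
      \<comment> \<open>The indices \<open>a\<close> and \<open>N - 1 - a\<close> are conjugate only
        for \<open>N = 0\<close>, when the middle block is empty; so here the order is
        immaterial.\<close>
      then have "N \<noteq> 0" by (auto simp: lo_def hi_def)
      then show "nord a (N - 1 - a) f = J a (J (N - 1 - a) f)"
        using J_commute[of a "N - 1 - a" f] by (simp add: nord_def)
    qed simp
    finally show ?case
      unfolding K_def lo_def[symmetric] hi_def[symmetric] g_def[symmetric] Sg by simp
  qed
qed

lemma K_add: "K N (f + g) = K N f + K N g"
proof -
  \<comment> \<open>The equation does not involve \<open>B\<close>, so it suffices to prove it for
    large \<open>B\<close>.\<close>
  have "\<forall>\<^sub>F B in sequentially. K N (f + g) = K N f + K N g"
    using K_eq_sum_nord[of N "f + g"] K_eq_sum_nord[of N f] K_eq_sum_nord[of N g]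
    by eventually_elim (simp add: nord_def J_add sum.distrib[symmetric] if_distrib cong: if_cong)
  then show ?thesis by simp
qed

lemma K_tconst_times: "K N (tconst c * f) = tconst c * K N f"
proof -
  have "\<forall>\<^sub>F B in sequentially. K N (tconst c * f) = tconst c * K N f"
    using K_eq_sum_nord[of N "tconst c * f"] K_eq_sum_nord[of N f]
    by eventually_elim (simp add: nord_def J_tconst_times sum_distrib_left if_distrib cong: if_cong)
  then show ?thesis by simp
qed

lemma K_0 [simp]: "K N 0 = 0"
  using K_tconst_times[of N 0 0] by simp

lemma K_diff: "K N (f - g) = K N f - K N g"
  using K_add[of N f "- g"] K_tconst_times[of N "-1" g] by (simp add: tconst_uminus)

lemma K_sum: "K N (sum f A) = (\<Sum>x\<in>A. K N (f x))"
  by (induction A rule: infinite_finite_induct) (simp_all add: K_add)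

text \<open>Only the products with a factor conjugate to \<open>J l\<close> contribute, at
  \<open>a = N + l\<close> and \<open>a = - l - 1\<close>; each yields half of the
  coefficient.\<close>

lemma K_J: "K N (J l f) = J l (K N f) - tconst (2 * of_int l + 1) * J (N + l) f"
proof -
  have "\<forall>\<^sub>F B in sequentially. K N (J l f) = J l (K N f) - tconst (2 * of_int l + 1) * J (N + l) f"
    using K_eq_sum_nord[of N "J l f"] K_eq_sum_nord[of N f]
      \<comment> \<open>This bound puts both contributing indices inside the window.\<close>
      eventually_ge_at_top[of "nat \<bar>N + l\<bar> + nat \<bar>l\<bar> + 1"]
  proof eventually_elim
    case (elim B)
    let ?A = "{N - int B..<int B}"
    let ?c = "- (2 * of_int l + 1) / 2 :: complex"
    have "K N (J l f) = J l (K N f)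
       + (\<Sum>a\<in>?A. tconst (if N - 1 - a + l + 1 = 0 then (2 * of_int (N - 1 - a) + 1) / 2 else 0) * J a f)
       + (\<Sum>a\<in>?A. tconst (if a + l + 1 = 0 then (2 * of_int a + 1) / 2 else 0) * J (N - 1 - a) f)"
      unfolding elim(1,2) by (simp only: nord_J sum.distrib J_sum)
    also have "(\<Sum>a\<in>?A. tconst (if N - 1 - a + l + 1 = 0 then (2 * of_int (N - 1 - a) + 1) / 2 else 0) * J a f)
        = (\<Sum>a\<in>?A. if a = N + l then tconst ?c * J a f else 0)"
      by (intro sum.cong) (auto intro!: arg_cong[where f = "\<lambda>c. tconst c * _"] simp: field_simps)
    also have "\<dots> = tconst ?c * J (N + l) f"
      using elim(3) by (subst sum.delta) auto
    also have "(\<Sum>a\<in>?A. tconst (if a + l + 1 = 0 then (2 * of_int a + 1) / 2 else 0) * J (N - 1 - a) f)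
        = (\<Sum>a\<in>?A. if a = - l - 1 then tconst ?c * J (N - 1 - a) f else 0)"
    proof (intro sum.cong refl)
      fix a
      show "tconst (if a + l + 1 = 0 then (2 * of_int a + 1) / 2 else 0) * J (N - 1 - a) f
          = (if a = - l - 1 then tconst ?c * J (N - 1 - a) f else 0)"
      proof (cases "a = - l - 1")
        case True
        have "(2 * of_int a + 1) / 2 = ?c" by (simp add: True field_simps)
        moreover have "a + l + 1 = 0" using True by simp
        ultimately show ?thesis using True by (simp only: if_P)
      next
        case False
        then have "a + l + 1 \<noteq> 0" by simp
        with False show ?thesis by simp
      qed
    qed
    also have "\<dots> = tconst ?c * J (N + l) f"
      using elim(3) by (subst sum.delta) auto
    finally have "K N (J l f) = J l (K N f) + (tconst ?c + tconst ?c) * J (N + l) f"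
      by (simp only: distrib_right add.assoc)
    also have "tconst ?c + tconst ?c = - tconst (2 * of_int l + 1)"
      unfolding tconst_add[symmetric] tconst_uminus[symmetric]
      by (rule arg_cong[where f = tconst]) (simp add: field_simps)
    finally show ?case by simp
  qed
  then show ?thesis by simp
qed

section \<open>The commutator of quadratic operators and its central term\<close>

text \<open>All derivatives kill 1, hence also \<open>D 1\<close>, which is therefore constant and
  so 0. Multiplication by a variable is a scalar multiple of a current, so the vanishing spreads to
  every polynomial.\<close>

lemma eq_0_if_commutes_J:
  assumes add: "\<And>f g. D (f + g) = D f + D g"
    and tconst: "\<And>c f. D (tconst c * f) = tconst c * D f"
    and J: "\<And>a f. D (J a f) = J a (D f)"
    and const_term: "Poly_Mapping.lookup (D 1) 0 = 0"
  shows "D f = 0"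
proof (induction f rule: tpoly_induct)
  case one
  have "D 0 = 0" using tconst[of 0 0] by simp
  then have "J (int j) (D 1) = 0" for j
    by (simp flip: J)
  then have "dvar (2 * int j + 1) (D 1) = 0" for j
    unfolding J_def by simp
  then show ?case
    using const_term by (rule tpoly_eq_0I)
next
  case (add f g)
  then show ?case by (simp add: assms(1))
next
  case (tconst c f)
  then show ?case by (simp add: assms(2))
next
  case (tvar j f)
  let ?c = "(2 * of_nat j + 1) / 2 :: complex"
  have "2 * of_nat j + 1 = (of_nat (Suc (2 * j)) :: complex)" by simp
  then have "2 * of_nat j + 1 \<noteq> (0 :: complex)" by (simp only: of_nat_neq_0 not_False_eq_True)
  then have "?c \<noteq> 0" by simp
  have c: "- (2 * of_int (- int j - 1) + 1) / 2 = ?c"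
    and j: "- (2 * (- int j - 1) + 1) = 2 * int j + 1"
    by (simp_all add: field_simps)
  have "J (- int j - 1) f = tconst ?c * (tvar (2 * int j + 1) * f)"
    by (subst J_neg) (simp_all only: c j)
  then have "tconst (1 / ?c) * J (- int j - 1) f
      = tconst (1 / ?c * ?c) * (tvar (2 * int j + 1) * f)"
    by (simp only: tconst_mult mult.assoc)
  moreover have "1 / ?c * ?c = 1" using \<open>?c \<noteq> 0\<close> by (rule nonzero_eq_divide_eq[THEN iffD1, OF _ refl])
  ultimately have "tvar (2 * int j + 1) * f = tconst (1 / ?c) * J (- int j - 1) f"
    by (simp only: tconst_1 mult_1)
  then show ?case
    using tvar by (simp add: assms(2,3))
qed

text \<open>Derivatives kill 1, so only products of two multiplications survive; these occur just in
  the middle block for negative \<open>M\<close>.\<close>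

lemma K_one: "K M 1 = (\<Sum>b\<in>{M..<0}. J b (J (M - 1 - b) 1))"
proof (cases "M \<ge> 0")
  case True
  then show ?thesis by (simp add: K_def)
next
  case False
  then show ?thesis by (simp add: K_def min_def max_def)
qed

lemma lookup_0_K_one: "Poly_Mapping.lookup (K M 1) 0 = 0"
  by (simp add: K_one lookup_sum)

text \<open>Moving \<open>K N\<close> past \<open>J b\<close> leaves one term headed by
  \<open>J b\<close>, without constant term, and a multiple of
  \<open>J (N + b) (J (M - 1 - b) 1)\<close>, whose constant term is nonzero only for conjugate
  currents.\<close>

lemma lookup_0_K_K_one:
  "Poly_Mapping.lookup (K N (K M 1)) 0 =
     (if N + M = 0 then \<Sum>b\<in>{M..<0}. - (2 * of_int b + 1) * (2 * of_int (b - M) + 1) / 2 else 0)"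
proof -
  have *: "Poly_Mapping.lookup (K N (J b (J (M - 1 - b) 1))) 0
      = (if N + M = 0 then - (2 * of_int b + 1) * (2 * of_int (b - M) + 1) / 2 else 0)"
    if b: "b \<in> {M..<0}" for b
  proof -
    have "Poly_Mapping.lookup (J (N + b) (J (M - 1 - b) 1)) 0
        = (if N + M = 0 then (2 * of_int (b - M) + 1) / 2 else 0)"
    proof (cases "N + b \<ge> 0")
      case True
      have "N + b + (M - 1 - b) + 1 = N + M" by simp
      then have "Poly_Mapping.lookup (J (N + b) (J (M - 1 - b) 1)) 0
          = (if N + M = 0 then (2 * of_int (N + b) + 1) / 2 else 0)"
        using True b by (subst J_commute) (simp add: lookup_add)
      also have "\<dots> = (if N + M = 0 then (2 * of_int (b - M) + 1) / 2 else 0)"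
      proof (cases "N + M = 0")
        case True
        then have "N + b = b - M" by simp
        then show ?thesis by simp
      qed simp
      finally show ?thesis .
    next
      case False
      \<comment> \<open>Here the outer current is a multiplication, and \<open>M \<le> b\<close>
        excludes \<open>N + M = 0\<close>.\<close>
      then show ?thesis using b by auto
    qed
    then show ?thesis
      using b by (simp add: K_J lookup_minus) (simp add: algebra_simps)
  qed
  have "Poly_Mapping.lookup (K N (K M 1)) 0
      = (\<Sum>b\<in>{M..<0}. Poly_Mapping.lookup (K N (J b (J (M - 1 - b) 1))) 0)"
    by (simp add: K_one K_sum lookup_sum)
  also have "\<dots> = (\<Sum>b\<in>{M..<0}. if N + M = 0 then - (2 * of_int b + 1) * (2 * of_int (b - M) + 1) / 2 else 0)"
    by (rule sum.cong[OF refl *])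
  finally show ?thesis by simp
qed

text \<open>Keeping \<open>x\<close> independent of the number \<open>m\<close> of terms lets the
  induction go through; the sum needed is the case \<open>x = m\<close>.\<close>

lemma sum_odd_products:
  "(\<Sum>i<m. (2 * of_nat i + 1) * (2 * (x - of_nat i) - 1) / 2 :: complex)
     = of_nat m ^ 2 * x - of_nat m * (4 * of_nat m ^ 2 - 1) / 6"
proof (induction m)
  case (Suc m)
  show ?case
    by (simp only: sum.lessThan_Suc Suc) (simp add: field_simps power2_eq_square)
qed simp

lemma central_sum:
  assumes "M \<le> 0"
  shows "(\<Sum>b\<in>{M..<0}. - (2 * of_int b + 1) * (2 * of_int (b - M) + 1) / 2 :: complex)
     = - (2 * of_int M ^ 3 + of_int M) / 6"
proof -
  obtain m where M: "M = - int m" using assms by (metis nonpos_int_cases)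
  have "(\<Sum>b\<in>{M..<0}. - (2 * of_int b + 1) * (2 * of_int (b - M) + 1) / 2 :: complex)
      = (\<Sum>i<m. (2 * of_nat i + 1) * (2 * (of_nat m - of_nat i) - 1) / 2)"
    by (rule sum.reindex_bij_witness[of _ "\<lambda>i. - int i - 1" "\<lambda>b. nat (- b - 1)"])
      (auto simp: M algebra_simps)
  also have "\<dots> = - (2 * of_int M ^ 3 + of_int M) / 6"
    unfolding sum_odd_products by (simp add: M field_simps power2_eq_square power3_eq_cube)
  finally show ?thesis .
qed

lemma K_commutator:
  "K N (K M f) - K M (K N f) = tconst (2 * of_int (N - M)) * K (N + M) f
     + tconst (if N + M = 0 then (2 * of_int N ^ 3 + of_int N) / 6 else 0) * f"
proof -
  define c :: complex where "c = (if N + M = 0 then (2 * of_int N ^ 3 + of_int N) / 6 else 0)"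
  define D where "D f = K N (K M f) - K M (K N f) - tconst (2 * of_int (N - M)) * K (N + M) f
      - tconst c * f" for f
  have "D f = 0"
  proof (rule eq_0_if_commutes_J[where D = D])
    show "D (f + g) = D f + D g" for f g
      by (simp add: D_def K_add algebra_simps)
    show "D (tconst c * f) = tconst c * D f" for c f
      by (simp add: D_def K_tconst_times) (simp add: algebra_simps)
    show "D (J l f) = J l (D f)" for l f
    proof -
      \<comment> \<open>By \<open>K_J\<close> everything left is a multiple of
        \<open>J (N + M + l) f\<close>; the coefficients cancel by the Jacobi computation.\<close>
      have "D (J l f) - J l (D f)
        = (tconst (2 * of_int l + 1) * tconst (2 * of_int (M + l) + 1)
           - tconst (2 * of_int l + 1) * tconst (2 * of_int (N + l) + 1)
           + tconst (2 * of_int (N - M)) * tconst (2 * of_int l + 1)) * J (N + M + l) f"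
        by (simp add: D_def K_J K_diff J_diff J_tconst_times K_tconst_times) (simp add: algebra_simps)
      also have "\<dots> = 0"
        by (simp flip: tconst_add tconst_diff tconst_mult) (simp add: algebra_simps)
      finally show ?thesis by simp
    qed
    \<comment> \<open>For \<open>N + M = 0\<close>, the first term carries the whole value if
      \<open>N \<ge> 0\<close>, the second if \<open>N < 0\<close>; the other sum is empty.\<close>
    have S: "Poly_Mapping.lookup (K N (K M 1)) 0 - Poly_Mapping.lookup (K M (K N 1)) 0 = c"
    proof (cases "N + M = 0")
      case True
      then have M: "M = - N" by simp
      show ?thesis
      proof (cases "N \<ge> 0")
        case N: True
        show ?thesis
          using N central_sum[of "- N"] by (simp add: lookup_0_K_K_one c_def M)
      next
        case N: False
        show ?thesis
          using N central_sum[of N] by (simp add: lookup_0_K_K_one c_def M)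
      qed
    qed (simp add: lookup_0_K_K_one c_def add.commute)
    show "Poly_Mapping.lookup (D 1) 0 = 0"
      using S by (simp add: D_def lookup_minus lookup_0_K_one)
  qed
  then show ?thesis
    unfolding D_def c_def by (simp add: algebra_simps)
qed

section \<open>From the quadratic operators to the Virasoro relations\<close>

lemma Z2_eq_K:
  assumes "p > 0"
  shows "Z2 p k f = 2 * K (k * int p) f"
proof -
  define N where "N = k * int p"
  have N: "2 * k * int p = 2 * N" "k * int p = N" by (simp_all add: N_def)
  show ?thesis
  proof (cases "k \<ge> 0")
    case True
    then have "N \<ge> 0" by (simp add: N_def)
    have "(\<Sum>n\<in>{0..N - 1}. dvar (2*n + 1) (dvar (2*N - 2*n - 1) f))
        = (\<Sum>a\<in>{0..<N}. J a (J (N - 1 - a) f))"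
      by (rule sum.cong) (auto simp: J_def algebra_simps)
    moreover have "of_nat (2*n + 1) * tvar (2*int n + 1) * dvar (2*N + 2*int n + 1) f
        = 2 * J (- 1 - int n) (J (N + int n) f)" for n
    proof -
      have "of_nat (2*n + 1) = 2 * (- (2 * of_int (- 1 - int n) + 1) / 2 :: complex)"
        by (simp add: field_simps)
      then have "of_nat (2*n + 1) = 2 * tconst (- (2 * of_int (- 1 - int n) + 1) / 2)"
        by (simp only: of_nat_eq_tconst numeral_eq_tconst tconst_mult)
      then show ?thesis
        using \<open>N \<ge> 0\<close> by (simp add: J_def algebra_simps)
    qed
    moreover have "finite {n. J (- 1 - int n) (J (N + int n) f) \<noteq> 0}"
      by (rule finite_J_nonzero[OF \<open>N \<ge> 0\<close>])
    ultimately show ?thesis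
      using True \<open>N \<ge> 0\<close> unfolding Z2_def N
      by (simp add: K_def Sum_any_right_distrib[symmetric] distrib_left)
  next
    case False
    then have "N < 0" using assms by (simp add: N_def mult_less_0_iff)
    have "tconst (1/2) * (\<Sum>n\<in>{0..- N - 1}. of_int ((2*n + 1) * (- 2*N - 2*n - 1))
             * tvar (2*n + 1) * tvar (- 2*N - 2*n - 1) * f)
        = 2 * (\<Sum>a\<in>{N..<0}. J a (J (N - 1 - a) f))"
      unfolding sum_distrib_left
    \<comment> \<open>The current of index \<open>- n - 1\<close> multiplies by the variable with
      subscript \<open>2n + 1\<close>. The weights of two currents contribute 1/4, which the factor
      2 turns into 1/2.\<close>
    proof (rule sum.reindex_bij_witness[of _ "\<lambda>a. - a - 1" "\<lambda>n. - n - 1"])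
      fix n assume n: "n \<in> {0..- N - 1}"
      have neg: "- n - 1 < 0" "N + n < 0" using n by auto
      have e: "N - 1 - (- n - 1) = N + n" "- (2 * (- n - 1) + 1) = 2*n + 1"
        "- (2 * (N + n) + 1) = - 2*N - 2*n - 1" by simp_all
      have "2 * J (- n - 1) (J (N - 1 - (- n - 1)) f)
        = (2 * tconst (- (2 * of_int (- n - 1) + 1) / 2) * tconst (- (2 * of_int (N + n) + 1) / 2))
           * (tvar (2*n + 1) * tvar (- 2*N - 2*n - 1) * f)"
        unfolding e(1) J_neg[OF neg(1)] J_neg[OF neg(2)] e(2,3) by (simp only: mult_ac)
      also have "2 * tconst (- (2 * of_int (- n - 1) + 1) / 2) * tconst (- (2 * of_int (N + n) + 1) / 2)
        = tconst (1/2) * of_int ((2*n + 1) * (- 2*N - 2*n - 1))"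
        unfolding of_int_eq_tconst numeral_eq_tconst tconst_mult[symmetric]
        by (rule arg_cong[where f = tconst]) (simp add: field_simps)
      finally show "2 * J (- n - 1) (J (N - 1 - (- n - 1)) f)
        = tconst (1/2) * (of_int ((2*n + 1) * (- 2*N - 2*n - 1))
             * tvar (2*n + 1) * tvar (- 2*N - 2*n - 1) * f)"
        by (simp only: mult_ac)
    qed auto
    moreover have "of_int (2*int n + 1 - 2*N) * tvar (2*int n + 1 - 2*N) * dvar (2*int n + 1) f
        = 2 * J (N - 1 - int n) (J (int n) f)" for n
    proof -
      have "of_int (2*int n + 1 - 2*N) = 2 * (- (2 * of_int (N - 1 - int n) + 1) / 2 :: complex)"
        by (simp add: field_simps)
      then have "of_int (2*int n + 1 - 2*N) = 2 * tconst (- (2 * of_int (N - 1 - int n) + 1) / 2)"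
        by (simp only: of_int_eq_tconst numeral_eq_tconst tconst_mult)
      then show ?thesis
        using \<open>N < 0\<close> by (simp add: J_def algebra_simps)
    qed
    moreover have "finite {n. J (N - 1 - int n) (J (int n) f) \<noteq> 0}"
      using finite_J_nonzero[of 0 "N - 1" f] by simp
    moreover have N': "- 2 * k * int p = - 2 * N" "- k * int p = - N" by (simp_all add: N_def)
    ultimately show ?thesis
      using False \<open>N < 0\<close> unfolding Z2_def N N'
      by (simp add: K_def Sum_any_right_distrib[symmetric] distrib_left)
  qed
qed

theorem mainTheorem5:
  fixes p :: nat
  assumes "p > 0" and "odd p"
  shows "\<forall>n m :: int. commutator (Lop p n) (Lop p m) =
    (\<lambda>f. of_int (n - m) * Lop p (n + m) f
       + tconst (if n + m = 0 then (of_int n ^ 3 - of_int n) / 12 * of_nat p else 0) * f)"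
proof (intro allI ext)
  fix n m :: int and f :: tpoly
  \<comment> \<open>The prefactor \<open>1 / (4p)\<close> combined with
    \<open>Z2 = 2 K\<close>.\<close>
  define s :: complex where "s = 1 / (2 * of_nat p)"
  define h :: "int \<Rightarrow> complex" where
    "h n = (if n = 0 then 1 / (16 * of_nat p) + (of_nat p ^ 2 - 1) / (24 * of_nat p) else 0)" for n
  have L: "Lop p n f = tconst s * K (n * int p) f + tconst (h n) * f" for n f
  proof -
    have "tconst (1 / (4 * of_nat p)) * 2 = tconst s"
      by (simp add: numeral_eq_tconst s_def flip: tconst_mult)
    then show ?thesis
      using assms by (simp add: Lop_def Z2_eq_K h_def mult.assoc[symmetric])
  qed
  define N M where "N = n * int p" and "M = m * int p"
  have NM: "(n + m) * int p = N + M" by (simp add: N_def M_def distrib_right)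
  define c :: complex where "c = (if N + M = 0 then (2 * of_int N ^ 3 + of_int N) / 6 else 0)"
  have "commutator (Lop p n) (Lop p m) f = tconst s * tconst s * (K N (K M f) - K M (K N f))"
    by (simp add: commutator_def L K_add K_tconst_times flip: N_def M_def) (simp add: algebra_simps)
  also have "\<dots> = tconst (s * s * (2 * of_int (N - M))) * K (N + M) f + tconst (s * s * c) * f"
    unfolding K_commutator c_def[symmetric] by (simp only: tconst_mult distrib_left mult.assoc)
  \<comment> \<open>\<open>N - M = (n - m) p\<close>, and \<open>2 p s = 1\<close> absorbs one
    factor \<open>s\<close>.\<close>
  also have "s * s * (2 * of_int (N - M)) = of_int (n - m) * s"
    using assms(1) by (simp add: s_def N_def M_def field_simps)
  also have "s * s * c = of_int (n - m) * h (n + m)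
      + (if n + m = 0 then (of_int n ^ 3 - of_int n) / 12 * of_nat p else 0)"
  proof (cases "n + m = 0")
    case True
    then have m: "m = - n" by simp
    \<comment> \<open>Both sides equal \<open>n^3 p / 12 + n / (24 p)\<close>: the term
      \<open>2 n h 0\<close> cancels \<open>- n p / 12\<close> from the cocycle and supplies the
      rest of the linear part.\<close>
    show ?thesis
      using assms(1)
      by (simp add: m s_def c_def h_def N_def M_def power2_eq_square power3_eq_cube divide_simps)
         (simp add: algebra_simps)
  next
    case False
    then have "N + M \<noteq> 0" using assms(1) by (simp flip: NM)
    then show ?thesis using False by (simp add: c_def h_def)
  qed
  also have "tconst (of_int (n - m) * s) * K (N + M) f + tconst (\<dots>) * f
      = of_int (n - m) * Lop p (n + m) f
       + tconst (if n + m = 0 then (of_int n ^ 3 - of_int n) / 12 * of_nat p else 0) * f"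
    unfolding L NM of_int_eq_tconst tconst_mult tconst_add
    by (simp only: distrib_left distrib_right ac_simps)
  finally show "commutator (Lop p n) (Lop p m) f = of_int (n - m) * Lop p (n + m) f
       + tconst (if n + m = 0 then (of_int n ^ 3 - of_int n) / 12 * of_nat p else 0) * f" .
qed

end
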